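(* Let $n\ge 1$ and let $A,B\in\mathbb{S}^n_+$. Then $$B\preceq_{\mathsf{L}}A\;\Leftrightarrow\; J_A\preceq_{\mathsf{L}}J_B\;\Leftrightarrow\; J_A\preceq J_B.$$
   Context: $\mathbb{S}^n$ is the set of real symmetric $n\times n$ matrices and $\mathbb{S}^n_+$ is the set of $A\in\mathbb{S}^n$ with $\langle x,Ax\rangle\ge 0$ for all $x\in\mathbb{R}^n$ (positive semidefinite matrices). Matrices are identified with linear operators on the Euclidean space $\mathbb{R}^n$. The Loewner order on $\mathbb{S}^n_+$ is $B\preceq_{\mathsf{L}}A :\Leftrightarrow A-B\in\mathbb{S}^n_+$. The resolvent of $A\in\mathbb{S}^n_+$ is $J_A=(\operatorname{Id}+A)^{-1}$, which is again in $\mathbb{S}^n_+$. A mapping $T\colon\mathbb{R}^n\to\mathbb{R}^n$ is firmly nonexpansive if $\|Tx-Ty\|^2\le\langle x-y,Tx-Ty\rangle$ for all $x,y\in\mathbb{R}^n$; resolvents $J_A$ with $A\in\mathbb{S}^n_+$ are firmly nonexpansive. The resolvent order on firmly nonexpansive mappings is $T_1\preceq T_2:\Leftrightarrow T_2-T_1$ is firmly nonexpansive. *)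

theory Defs
  imports "HOL-Analysis.Analysis"
begin

definition sym_matrices :: "(real ^ 'n ^ 'n) set" where
  "sym_matrices = {A. transpose A = A}"

definition psd_matrices :: "(real ^ 'n ^ 'n) set" where
  "psd_matrices = {A \<in> sym_matrices. \<forall>x. 0 \<le> x \<bullet> (A *v x)}"

definition loewner_le :: "real ^ 'n ^ 'n \<Rightarrow> real ^ 'n ^ 'n \<Rightarrow> bool" (infix "\<preceq>\<^sub>L" 50) where
  "B \<preceq>\<^sub>L A \<longleftrightarrow> A - B \<in> psd_matrices"

text \<open>The inverse is meaningful for positive semidefinite \<open>A\<close>: see
  \<open>invertible_id_plus_psd\<close> below.\<close>
definition resolvent :: "real ^ 'n ^ 'n \<Rightarrow> real ^ 'n ^ 'n" where
  "resolvent A = matrix_inv (mat 1 + A)"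

definition firmly_nonexpansive :: "('a::real_inner \<Rightarrow> 'a) \<Rightarrow> bool" where
  "firmly_nonexpansive T \<longleftrightarrow> (\<forall>x y. (norm (T x - T y))\<^sup>2 \<le> (x - y) \<bullet> (T x - T y))"

definition resolvent_le :: "('a::real_inner \<Rightarrow> 'a) \<Rightarrow> ('a \<Rightarrow> 'a) \<Rightarrow> bool" (infix "\<preceq>\<^sub>R" 50) where
  "T\<^sub>1 \<preceq>\<^sub>R T\<^sub>2 \<longleftrightarrow> firmly_nonexpansive (\<lambda>x. T\<^sub>2 x - T\<^sub>1 x)"

text \<open>Both orders are relations on restricted carriers (positive semidefinite matrices,
  firmly nonexpansive maps). The following facts show that resolvents of positive
  semidefinite matrices are well defined and lie in these carriers.\<close>

lemma invertible_id_plus_psd: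
  fixes A :: "real ^ 'n ^ 'n"
  assumes "A \<in> psd_matrices"
  shows "invertible (mat 1 + A)"
proof -
  have "x = 0" if "(mat 1 + A) *v x = 0" for x :: "real ^ 'n"
  proof -
    have "x \<bullet> x + x \<bullet> (A *v x) = x \<bullet> ((mat 1 + A) *v x)"
      by (simp add: matrix_vector_mult_add_rdistrib inner_right_distrib)
    moreover have "0 \<le> x \<bullet> (A *v x)"
      using assms by (simp add: psd_matrices_def)
    ultimately have "x \<bullet> x \<le> 0"
      using that by simp
    then show "x = 0"
      using inner_gt_zero_iff[of x] by linarith
  qed
  then show ?thesis
    by (auto simp: invertible_left_inverse matrix_left_invertible_ker)
qed

lemma resolvent_inverse:
  fixes A :: "real ^ 'n ^ 'n"
  assumes "A \<in> psd_matrices"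
  shows "(mat 1 + A) ** resolvent A = mat 1" "resolvent A ** (mat 1 + A) = mat 1"
  using someI_ex[OF invertible_id_plus_psd[OF assms, unfolded invertible_def]]
  by (simp_all add: resolvent_def matrix_inv_def)

lemma resolvent_inner:
  fixes A :: "real ^ 'n ^ 'n"
  assumes "A \<in> psd_matrices"
  shows "(norm (resolvent A *v x))\<^sup>2 \<le> x \<bullet> (resolvent A *v x)"
proof -
  define y where "y = resolvent A *v x"
  have x: "x = y + A *v y"
  proof -
    have "(mat 1 + A) *v y = x"
      by (simp add: y_def matrix_vector_mul_assoc resolvent_inverse(1)[OF assms])
    then show ?thesis
      by (simp add: matrix_vector_mult_add_rdistrib)
  qed
  have "0 \<le> y \<bullet> (A *v y)"
    using assms by (simp add: psd_matrices_def)
  moreover have "x \<bullet> y = y \<bullet> y + y \<bullet> (A *v y)"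
    by (metis x inner_commute inner_right_distrib)
  ultimately have "(norm y)\<^sup>2 \<le> x \<bullet> y"
    by (simp add: power2_norm_eq_inner)
  then show ?thesis by (simp add: y_def)
qed

lemma resolvent_psd:
  fixes A :: "real ^ 'n ^ 'n"
  assumes "A \<in> psd_matrices"
  shows "resolvent A \<in> psd_matrices"
proof -
  have A: "transpose (mat 1 + A) = mat 1 + A"
    using assms by (simp add: psd_matrices_def sym_matrices_def transpose_def mat_def vec_eq_iff)
  have "transpose (resolvent A) ** (mat 1 + A) = mat 1"
    using arg_cong[OF resolvent_inverse(1)[OF assms], of transpose]
    by (simp add: matrix_transpose_mul A transpose_mat)
  then have "transpose (resolvent A) ** ((mat 1 + A) ** resolvent A) = resolvent A"
    by (simp add: matrix_mul_assoc)
  then have "transpose (resolvent A) = resolvent A"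
    by (simp add: resolvent_inverse(1)[OF assms])
  moreover have "0 \<le> x \<bullet> (resolvent A *v x)" for x
    using order_trans[OF zero_le_power2 resolvent_inner[OF assms, of x]] .
  ultimately show ?thesis
    by (simp add: psd_matrices_def sym_matrices_def)
qed

lemma resolvent_firmly_nonexpansive:
  fixes A :: "real ^ 'n ^ 'n"
  assumes "A \<in> psd_matrices"
  shows "firmly_nonexpansive ((*v) (resolvent A))"
  unfolding firmly_nonexpansive_def
proof (intro allI)
  fix x y :: "real ^ 'n"
  show "(norm (resolvent A *v x - resolvent A *v y))\<^sup>2 \<le>
    (x - y) \<bullet> (resolvent A *v x - resolvent A *v y)"
    using resolvent_inner[OF assms, of "x - y"]
    by (simp only: matrix_vector_mult_diff_distrib)
qed

end

theory Submission
  imports Defs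
begin

text \<open>
  Both equivalences reduce to statements about quadratic forms.

  The quadratic form of the inverse \<open>N\<close> of a positive semidefinite invertible matrix \<open>M\<close> is the
  Legendre transform of that of \<open>M\<close>:
  \<open>x \<bullet> N x = max\<^sub>y (2 (x \<bullet> y) - y \<bullet> M y)\<close>, attained at \<open>y = N x\<close>. The right-hand side decreases
  when \<open>M\<close> increases, so inversion reverses the Loewner order (\<open>loewner_le_inverse\<close>). As inversion
  is an involution and adding \<open>Id\<close> changes no difference, this gives both directions of the first
  equivalence.

  For the second one, let \<open>D = J\<^sub>B - J\<^sub>A\<close>. A linear map \<open>D\<close> is firmly nonexpansive if and only if
  \<open>\<parallel>D x\<parallel>\<^sup>2 \<le> x \<bullet> D x\<close> for all \<open>x\<close>, that is, \<open>D\<^sup>2 \<preceq>\<^sub>L D\<close> when \<open>D\<close> is symmetric. This clearly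
  forces \<open>0 \<preceq>\<^sub>L D\<close>. Conversely, \<open>D \<preceq>\<^sub>L Id\<close> holds because \<open>J\<^sub>B \<preceq>\<^sub>L Id\<close> and \<open>0 \<preceq>\<^sub>L J\<^sub>A\<close>, and a
  symmetric matrix between \<open>0\<close> and \<open>Id\<close> has \<open>D\<^sup>2 \<preceq>\<^sub>L D\<close> (\<open>norm_square_le_inner_of_psd\<close>).
\<close>

lemma inner_symmetric_matrix:
  fixes M :: "real ^ 'n ^ 'n"
  assumes "M \<in> sym_matrices"
  shows "(M *v x) \<bullet> y = x \<bullet> (M *v y)"
proof -
  have "x v* M = M *v x"
    using assms transpose_matrix_vector[of M x] by (simp add: sym_matrices_def)
  then show ?thesis
    by (metis dot_lmul_matrix)
qed

lemma sym_matrices_diff: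
  fixes M N :: "real ^ 'n ^ 'n"
  assumes "M \<in> sym_matrices" "N \<in> sym_matrices"
  shows "M - N \<in> sym_matrices"
  using assms by (simp add: sym_matrices_def transpose_def vec_eq_iff)

lemma loewner_le_iff:
  fixes M N :: "real ^ 'n ^ 'n"
  assumes "M \<in> sym_matrices" "N \<in> sym_matrices"
  shows "N \<preceq>\<^sub>L M \<longleftrightarrow> (\<forall>x. x \<bullet> (N *v x) \<le> x \<bullet> (M *v x))"
  using sym_matrices_diff[OF assms]
  by (simp add: loewner_le_def psd_matrices_def matrix_vector_mult_diff_rdistrib inner_diff_right)

text \<open>Completing the square: the difference of the two sides is the value of the form \<open>M\<close> at
  \<open>y - N x\<close>.\<close>

lemma inner_inverse_ge:
  fixes M N :: "real ^ 'n ^ 'n"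
  assumes "M \<in> psd_matrices" and "M ** N = mat 1"
  shows "2 * (x \<bullet> y) - y \<bullet> (M *v y) \<le> x \<bullet> (N *v x)"
proof -
  define z where "z = N *v x"
  have sym: "M \<in> sym_matrices"
    using assms(1) by (simp add: psd_matrices_def)
  have Mz: "M *v z = x"
    by (simp add: z_def matrix_vector_mul_assoc assms(2))
  have "z \<bullet> (M *v y) = x \<bullet> y"
    using inner_symmetric_matrix[OF sym, of z y] Mz by simp
  then have "(y - z) \<bullet> (M *v (y - z)) = y \<bullet> (M *v y) - 2 * (x \<bullet> y) + x \<bullet> z"
    by (simp add: matrix_vector_mult_diff_distrib Mz inner_diff_left inner_diff_right
        inner_commute)
  moreover have "0 \<le> (y - z) \<bullet> (M *v (y - z))"
    using assms(1) by (simp add: psd_matrices_def)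
  ultimately show ?thesis
    by (simp add: z_def)
qed

lemma loewner_le_inverse:
  fixes M M' N N' :: "real ^ 'n ^ 'n"
  assumes "M' \<in> psd_matrices" "M ** N = mat 1" "M' ** N' = mat 1"
    and "N \<in> sym_matrices" "N' \<in> sym_matrices" "M' \<preceq>\<^sub>L M"
  shows "N \<preceq>\<^sub>L N'"
  unfolding loewner_le_iff[OF assms(5,4)]
proof
  fix x :: "real ^ 'n"
  \<comment> \<open>The maximiser of the variational formula for \<open>N\<close> is a competitor in the one for \<open>N'\<close>.\<close>
  define y where "y = N *v x"
  have My: "M *v y = x"
    by (simp add: y_def matrix_vector_mul_assoc assms(2))
  have "0 \<le> y \<bullet> ((M - M') *v y)"
    using assms(6) by (simp add: loewner_le_def psd_matrices_def)
  then have "y \<bullet> (M' *v y) \<le> x \<bullet> y"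
    by (simp add: matrix_vector_mult_diff_rdistrib inner_diff_right My inner_commute)
  then show "x \<bullet> (N *v x) \<le> x \<bullet> (N' *v x)"
    using inner_inverse_ge[OF assms(1,3), of x y] by (simp add: y_def)
qed

lemma id_plus_psd:
  fixes A :: "real ^ 'n ^ 'n"
  assumes "A \<in> psd_matrices"
  shows "mat 1 + A \<in> psd_matrices"
proof -
  have "transpose (mat 1 + A) = mat 1 + A"
    using assms by (simp add: psd_matrices_def sym_matrices_def transpose_def mat_def vec_eq_iff)
  then show ?thesis
    using assms
    by (simp add: psd_matrices_def sym_matrices_def matrix_vector_mult_add_rdistrib
        inner_right_distrib)
qed

text \<open>Expand \<open>0 \<le> \<parallel>x - J\<^sub>A x\<parallel>\<^sup>2\<close> and use firm nonexpansiveness of \<open>J\<^sub>A\<close>.\<close>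

lemma inner_resolvent_le:
  fixes A :: "real ^ 'n ^ 'n"
  assumes "A \<in> psd_matrices"
  shows "x \<bullet> (resolvent A *v x) \<le> x \<bullet> x"
proof -
  let ?y = "resolvent A *v x"
  have "0 \<le> (x - ?y) \<bullet> (x - ?y)"
    by (rule inner_ge_zero)
  also have "\<dots> = x \<bullet> x - 2 * (x \<bullet> ?y) + ?y \<bullet> ?y"
    by (simp add: inner_diff_left inner_diff_right inner_commute)
  finally show ?thesis
    using resolvent_inner[OF assms, of x] by (simp add: power2_norm_eq_inner)
qed

text \<open>In terms of matrices: \<open>D - D\<^sup>2 = (Id - D) D (Id - D) + D (Id - D) D\<close>, and both summands
  are positive semidefinite when \<open>0 \<preceq>\<^sub>L D \<preceq>\<^sub>L Id\<close>. This avoids square roots and spectral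
  theory.\<close>

lemma norm_square_le_inner_of_psd:
  fixes D :: "real ^ 'n ^ 'n"
  assumes "D \<in> psd_matrices" and "\<And>x. x \<bullet> (D *v x) \<le> x \<bullet> x"
  shows "(norm (D *v x))\<^sup>2 \<le> x \<bullet> (D *v x)"
proof -
  let ?y = "D *v x"
  have sym: "D \<in> sym_matrices"
    using assms(1) by (simp add: psd_matrices_def)
  have "0 \<le> (x - ?y) \<bullet> (D *v (x - ?y))"
    using assms(1) by (simp add: psd_matrices_def)
  also have "\<dots> = x \<bullet> ?y - 2 * (?y \<bullet> ?y) + ?y \<bullet> (D *v ?y)"
    using inner_symmetric_matrix[OF sym, of x ?y]
    by (simp add: matrix_vector_mult_diff_distrib inner_diff_left inner_diff_right)
  also have "\<dots> \<le> x \<bullet> ?y - ?y \<bullet> ?y"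
    using assms(2)[of ?y] by simp
  finally show ?thesis
    by (simp add: power2_norm_eq_inner)
qed

lemma firmly_nonexpansive_matrix_iff:
  fixes D :: "real ^ 'n ^ 'n"
  shows "firmly_nonexpansive ((*v) D) \<longleftrightarrow> (\<forall>x. (norm (D *v x))\<^sup>2 \<le> x \<bullet> (D *v x))"
  unfolding firmly_nonexpansive_def matrix_vector_mult_diff_distrib[symmetric]
  by (metis diff_zero)

theorem mainTheorem4:
  fixes A B :: "real ^ 'n ^ 'n"
  assumes "A \<in> psd_matrices" and "B \<in> psd_matrices"
  shows "(B \<preceq>\<^sub>L A \<longleftrightarrow> resolvent A \<preceq>\<^sub>L resolvent B) \<and>
         (resolvent A \<preceq>\<^sub>L resolvent B \<longleftrightarrow>
            (*v) (resolvent A) \<preceq>\<^sub>R (*v) (resolvent B))"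
proof
  note JA = resolvent_psd[OF assms(1)] and JB = resolvent_psd[OF assms(2)]
  note IA = id_plus_psd[OF assms(1)] and IB = id_plus_psd[OF assms(2)]
  have sym: "M \<in> sym_matrices" if "M \<in> psd_matrices" for M :: "real ^ 'n ^ 'n"
    using that by (simp add: psd_matrices_def)
  have shift: "B \<preceq>\<^sub>L A \<longleftrightarrow> mat 1 + B \<preceq>\<^sub>L mat 1 + A"
    by (simp add: loewner_le_def)
  show "B \<preceq>\<^sub>L A \<longleftrightarrow> resolvent A \<preceq>\<^sub>L resolvent B"
    unfolding shift
  proof
    assume "mat 1 + B \<preceq>\<^sub>L mat 1 + A"
    then show "resolvent A \<preceq>\<^sub>L resolvent B"
      by (rule loewner_le_inverse[OF IB resolvent_inverse(1)[OF assms(1)]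
            resolvent_inverse(1)[OF assms(2)] sym[OF JA] sym[OF JB]])
  next
    assume "resolvent A \<preceq>\<^sub>L resolvent B"
    then show "mat 1 + B \<preceq>\<^sub>L mat 1 + A"
      by (rule loewner_le_inverse[OF JA resolvent_inverse(2)[OF assms(2)]
            resolvent_inverse(2)[OF assms(1)] sym[OF IB] sym[OF IA]])
  qed
  define D where "D = resolvent B - resolvent A"
  have D_sym: "D \<in> sym_matrices"
    unfolding D_def by (rule sym_matrices_diff[OF sym[OF JB] sym[OF JA]])
  have D_le: "x \<bullet> (D *v x) \<le> x \<bullet> x" for x
  proof -
    have "0 \<le> x \<bullet> (resolvent A *v x)"
      using JA by (simp add: psd_matrices_def)
    then show ?thesis
      using inner_resolvent_le[OF assms(2), of x]
      by (simp add: D_def matrix_vector_mult_diff_rdistrib inner_diff_right)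
  qed
  have "resolvent A \<preceq>\<^sub>L resolvent B \<longleftrightarrow> D \<in> psd_matrices"
    by (simp add: loewner_le_def D_def)
  also have "\<dots> \<longleftrightarrow> (\<forall>x. (norm (D *v x))\<^sup>2 \<le> x \<bullet> (D *v x))"
  proof
    assume "D \<in> psd_matrices"
    then show "\<forall>x. (norm (D *v x))\<^sup>2 \<le> x \<bullet> (D *v x)"
      using norm_square_le_inner_of_psd D_le by blast
  next
    assume "\<forall>x. (norm (D *v x))\<^sup>2 \<le> x \<bullet> (D *v x)"
    then have "0 \<le> x \<bullet> (D *v x)" for x
      using order_trans[OF zero_le_power2] by blast
    then show "D \<in> psd_matrices"
      using D_sym by (simp add: psd_matrices_def)
  qed
  also have "\<dots> \<longleftrightarrow> (*v) (resolvent A) \<preceq>\<^sub>R (*v) (resolvent B)"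
    unfolding firmly_nonexpansive_matrix_iff[symmetric]
    by (simp add: resolvent_le_def D_def matrix_vector_mult_diff_rdistrib[abs_def])
  finally show "resolvent A \<preceq>\<^sub>L resolvent B \<longleftrightarrow>
      (*v) (resolvent A) \<preceq>\<^sub>R (*v) (resolvent B)" .
qed

end
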